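(* Let $n=1,2,\ldots$, let $\beta\in\mathbb{R}$, and let $\alpha=l/k$ be rational, with $l,k$ positive integers and $0<l/k<1$. Then for $z\in\mathbb{C}$, $$F_{\frac{l}{k}, \beta}^{(n)}(z) = \sum_{j=0}^{k-1} \frac{z^{j}}{[\Gamma(\beta + \frac{l}{k}j)]^{n}}\; {_{1}F_{nl}}\bigg({1 \atop \underbrace{\Delta(l, \beta + \tfrac{l}{k}j), \ldots, \Delta(l, \beta + \tfrac{l}{k}j)}_{n\ \text{times}}}; \frac{z^{k}}{l^{nl}}\bigg).$$
   Context: For $\alpha>0$, $\beta\in\mathbb{R}$ and a positive integer $n$, the Mittag-Leffler function of Le Roy type is the entire function $F^{(n)}_{\alpha,\beta}(z)=\sum_{r=0}^{\infty} \frac{z^{r}}{[\Gamma(\beta+\alpha r)]^{n}}$ of the complex variable $z$. For a positive integer $r$ and a number $\lambda$, $\Delta(r,\lambda)$ denotes the sequence of $r$ elements $\frac{\lambda}{r}, \frac{\lambda+1}{r},\ldots,\frac{\lambda+r-1}{r}$. The generalized hypergeometric function is defined by the series ${_{p}F_{q}}\Big({c_1,\ldots,c_p \atop d_1,\ldots,d_q}; x\Big)=\sum_{r=0}^{\infty}\frac{x^{r}}{r!}\frac{(c_1)_r\cdots(c_p)_r}{(d_1)_r\cdots(d_q)_r}$, where $(c)_r=\Gamma(c+r)/\Gamma(c)$ is the Pochhammer symbol (rising factorial).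
   Formalization: If β+(l/k)j is a nonpositive integer for some j<k, the j-th summand is undefined (a pole of Γ and a zero denominator in the hypergeometric series); such summands are read as their limits as the parameter tends to β, and for all other β the identity is stated literally. *)

theory Defs
  imports "HOL-Analysis.Analysis"
begin

(* rGamma is the entire reciprocal Gamma function: it vanishes at the poles of Gamma, so the
   terms of the series with \<beta> + \<alpha> r a nonpositive integer are 0, as usual. *)
definition le_roy :: "nat \<Rightarrow> real \<Rightarrow> real \<Rightarrow> complex \<Rightarrow> complex" where
  "le_roy n \<alpha> \<beta> z = (\<Sum>r. z ^ r * complex_of_real (rGamma (\<beta> + \<alpha> * real r)) ^ n)"

definition Delta_seq :: "nat \<Rightarrow> complex \<Rightarrow> complex list" where
  "Delta_seq r a = map (\<lambda>i. (a + of_nat i) / of_nat r) [0..<r]"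

(* The length of cs is p and that of ds is q. The series is meaningful only if no element of ds
   is a nonpositive integer; otherwise denominators vanish and x / 0 = 0 applies. *)
definition hypergeom_pFq :: "complex list \<Rightarrow> complex list \<Rightarrow> complex \<Rightarrow> complex" where
  "hypergeom_pFq cs ds x =
     (\<Sum>r. x ^ r / fact r *
        (prod_list (map (\<lambda>c. pochhammer c r) cs) / prod_list (map (\<lambda>d. pochhammer d r) ds)))"

lemma foldl_times_prod_list:
  fixes a :: "'a::comm_monoid_mult"
  shows "foldl (\<lambda>r c. r * f c) a cs = a * prod_list (map f cs)"
  by (induction cs arbitrary: a) (simp_all add: mult.assoc)

text \<open>Agreement with the formal hypergeometric series of the library.\<close>
lemma hypergeom_pFq_eq_eval_fps: "hypergeom_pFq cs ds x = eval_fps (fps_hypergeo cs ds 1) x"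
  by (simp add: hypergeom_pFq_def eval_fps_def foldl_times_prod_list mult_ac)

end

theory Submission
  imports Defs
begin

text \<open>
  Splitting the summation index by its residue modulo \<open>k\<close> turns the series with parameter
  \<open>l/k\<close> into \<open>k\<close> series with the integer parameter \<open>l\<close>, and each of these is hypergeometric by
  the multiplication formula for the Pochhammer symbol. If \<open>\<beta> + (l/k) j\<close> is a nonpositive integer,
  the corresponding series is still the limit of the right-hand side, because it converges
  locally uniformly in \<open>\<beta>\<close> and nonpositive integers are isolated.
\<close>

text \<open>Passing from \<open>m\<close> to \<open>Suc m\<close> appends the \<open>l\<close>
  consecutive factors \<open>s + l m + i\<close> with \<open>i < l\<close> on the left. Each is
  \<open>l\<close> times the new last factor of the \<open>i\<close>-th symbol on the right, so
  induction on \<open>m\<close> closes.\<close>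

lemma pochhammer_mult_nat:
  fixes s :: "'a::field_char_0"
  assumes "l > 0"
  shows "pochhammer s (l * m) = of_nat l ^ (l * m) * (\<Prod>i<l. pochhammer ((s + of_nat i) / of_nat l) m)"
proof (induction m)
  case 0
  show ?case by simp
next
  case (Suc m)
  have "pochhammer (s + of_nat (l * m)) l
      = (\<Prod>i<l. of_nat l * ((s + of_nat i) / of_nat l + of_nat m))"
    unfolding pochhammer_prod atLeast0LessThan using assms
    by (intro prod.cong) (auto simp: field_simps)
  also have "\<dots> = of_nat l ^ l * (\<Prod>i<l. (s + of_nat i) / of_nat l + of_nat m)"
    by (simp only: prod.distrib prod_constant card_lessThan)
  finally have step: "pochhammer (s + of_nat (l * m)) l
      = of_nat l ^ l * (\<Prod>i<l. (s + of_nat i) / of_nat l + of_nat m)" .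
  have "pochhammer s (l * Suc m) = pochhammer s (l * m) * pochhammer (s + of_nat (l * m)) l"
    using pochhammer_product'[of s "l * m" l] by (simp add: add.commute)
  also have "\<dots> = of_nat l ^ (l * Suc m) *
      (\<Prod>i<l. pochhammer ((s + of_nat i) / of_nat l) m * ((s + of_nat i) / of_nat l + of_nat m))"
    unfolding Suc.IH step prod.distrib by (simp add: power_add mult_ac)
  finally show ?case
    by (simp add: pochhammer_Suc)
qed

lemma prod_list_concat_replicate:
  "prod_list (map f (concat (replicate n xs))) = (prod_list (map f xs) :: 'a::comm_monoid_mult) ^ n"
  by (induction n) simp_all

lemma prod_list_pochhammer_Delta_seq:
  assumes "l > 0"
  shows "of_nat l ^ (l * m) * prod_list (map (\<lambda>d. pochhammer d m) (Delta_seq l a)) = pochhammer a (l * m)"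
proof -
  have "prod_list (map (\<lambda>d. pochhammer d m) (Delta_seq l a))
      = (\<Prod>i<l. pochhammer ((a + of_nat i) / of_nat l) m)"
    by (simp add: Delta_seq_def comp_def atLeast0LessThan flip: prod.distinct_set_conv_list)
  then show ?thesis
    by (simp add: pochhammer_mult_nat[OF assms])
qed

text \<open>The quotient of the two values of \<open>rGamma\<close> is
  \<open>pochhammer x l\<close>, whose first factor is \<open>x\<close> and whose other factors are
  at least 1. This controls the ratio of consecutive terms of the Le Roy series with integer step
  \<open>l\<close>.\<close>

lemma rGamma_add_nat_abs_le:
  fixes x :: real
  assumes "x \<ge> 1" and "l > 0"
  shows "\<bar>rGamma (x + real l)\<bar> \<le> \<bar>rGamma x\<bar> / x"
proof -
  have eq: "rGamma x = rGamma (x + real l) * pochhammer x l"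
    using pochhammer_rGamma[of x l] by (simp add: mult.commute)
  obtain m where l: "l = Suc m"
    using assms(2) not0_implies_Suc by blast
  have "1 \<le> pochhammer (x + 1) m"
    unfolding pochhammer_prod using assms(1) by (intro prod_ge_1) auto
  then have "x \<le> pochhammer x l"
    using assms(1) by (simp add: l pochhammer_rec)
  then have "\<bar>rGamma (x + real l)\<bar> * x \<le> \<bar>rGamma (x + real l)\<bar> * pochhammer x l"
    by (intro mult_left_mono) auto
  also have "\<dots> = \<bar>rGamma x\<bar>"
    using eq \<open>x \<le> pochhammer x l\<close> assms(1) by (simp add: abs_mult)
  finally show ?thesis
    using assms(1) by (simp add: field_simps)
qed

lemma continuous_on_le_roy_term:
  "continuous_on A (\<lambda>s. w ^ r * complex_of_real (rGamma (s + c)) ^ n)"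
  by (intro continuous_intros continuous_on_compose2[OF continuous_on_rGamma[of UNIV]]) auto

text \<open>Weierstrass M-test: from an index \<open>N\<close> that works for all \<open>s\<close>
  in the interval, each term is at most half of its predecessor in norm, so a geometric series
  dominates the tail.\<close>

lemma le_roy_uniform_limit:
  assumes "n > 0" and "l > 0"
  shows "uniform_limit {a..b}
           (\<lambda>m s. \<Sum>r<m. w ^ r * complex_of_real (rGamma (s + real l * real r)) ^ n)
           (\<lambda>s. le_roy n (real l) s w) sequentially"
proof -
  define f where "f = (\<lambda>r s. w ^ r * complex_of_real (rGamma (s + real l * real r)) ^ n)"
  \<comment> \<open>This choice forces \<open>s + l r\<close> to be at least
    \<open>2 * norm w + 1\<close> for every \<open>s \<ge> a\<close> and
    \<open>r \<ge> N\<close>.\<close>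
  obtain N :: nat where N: "2 * norm w + 1 + \<bar>a\<bar> \<le> real N"
    using real_arch_simple by blast
  have "continuous_on {a..b} (f N)"
    unfolding f_def by (rule continuous_on_le_roy_term)
  then obtain B where B: "\<And>s. s \<in> {a..b} \<Longrightarrow> norm (f N s) \<le> B"
    using compact_continuous_image[of "{a..b}" "f N"] compact_imp_bounded[of "f N ` {a..b}"]
    by (force simp: bounded_iff)
  have halve: "norm (f (Suc r) s) \<le> norm (f r s) / 2" if "s \<in> {a..b}" "r \<ge> N" for r s
  proof -
    define x where "x = s + real l * real r"
    have "real N \<le> real l * real r"
      using mult_mono[of 1 "real l" "real N" "real r"] assms(2) that(2) by simp
    then have x: "x \<ge> 1" "x \<ge> 2 * norm w"
      using N that(1) norm_ge_zero[of w] unfolding x_def atLeastAtMost_iff by linarith+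
    have "\<bar>rGamma (x + real l)\<bar> ^ n \<le> (\<bar>rGamma x\<bar> / x) ^ n"
      using rGamma_add_nat_abs_le[OF x(1) assms(2)] by (intro power_mono) auto
    \<comment> \<open>A single factor \<open>1 / x\<close> already absorbs \<open>norm w\<close>; it
      is available because \<open>x \<le> x ^ n\<close> for \<open>x \<ge> 1\<close> and
      \<open>n > 0\<close>.\<close>
    also have "\<dots> \<le> \<bar>rGamma x\<bar> ^ n / x"
      unfolding power_divide using x(1) assms(1) self_le_power[of x n]
      by (intro divide_left_mono) auto
    finally have "norm w * \<bar>rGamma (x + real l)\<bar> ^ n \<le> norm w * (\<bar>rGamma x\<bar> ^ n / x)"
      by (intro mult_left_mono) auto
    also have "\<dots> = (norm w / x) * \<bar>rGamma x\<bar> ^ n"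
      by simp
    also have "\<dots> \<le> (1 / 2) * \<bar>rGamma x\<bar> ^ n"
      using x by (intro mult_right_mono) (auto simp: field_simps)
    finally have "norm w ^ r * (norm w * \<bar>rGamma (x + real l)\<bar> ^ n) \<le> norm w ^ r * ((1 / 2) * \<bar>rGamma x\<bar> ^ n)"
      by (intro mult_left_mono) auto
    moreover have "s + real l * real (Suc r) = x + real l"
      by (simp add: x_def algebra_simps)
    ultimately show ?thesis
      by (simp add: f_def x_def[symmetric] norm_mult norm_power mult_ac del: of_nat_Suc)
  qed
  have bound: "norm (f (N + d) s) \<le> B * (1 / 2) ^ d" if "s \<in> {a..b}" for d s
  proof (induction d)
    case 0
    show ?case using B[OF that] by simp
  next
    case (Suc d)
    then show ?case using halve[OF that, of "N + d"] by simp
  qed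
  have "uniform_limit {a..b} (\<lambda>m s. \<Sum>r<m. f r s) (\<lambda>s. suminf (\<lambda>r. f r s)) sequentially"
  proof (rule Weierstrass_m_test_ev)
    \<comment> \<open>The subtraction \<open>r - N\<close> is truncated, so the majorant is the
      constant \<open>B\<close> for \<open>r < N\<close>; the estimate is claimed only
      eventually.\<close>
    show "\<forall>\<^sub>F r in sequentially. \<forall>s\<in>{a..b}. norm (f r s) \<le> B * (1 / 2) ^ (r - N)"
      using eventually_ge_at_top[of N]
    proof eventually_elim
      case (elim r)
      then show ?case using bound[of _ "r - N"] by simp
    qed
    have "summable (\<lambda>d. B * (1 / 2) ^ (d + N - N))"
      by (simp add: summable_geometric summable_mult)
    then show "summable (\<lambda>r. B * (1 / 2) ^ (r - N))"
      by (rule summable_iff_shift[THEN iffD1])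
  qed
  then show ?thesis
    by (simp add: f_def le_roy_def)
qed

lemma sums_le_roy:
  assumes "n > 0" and "l > 0"
  shows "(\<lambda>r. w ^ r * complex_of_real (rGamma (s + real l * real r)) ^ n) sums le_roy n (real l) s w"
  \<comment> \<open>On the one-point interval from \<open>s\<close> to \<open>s\<close>, uniform
    convergence is convergence at \<open>s\<close>.\<close>
  using tendsto_uniform_limitI[OF le_roy_uniform_limit[OF assms, where a = s and b = s and w = w], of s]
  by (simp add: sums_def)

text \<open>The partial sums are continuous and converge uniformly on an interval with
  \<open>s\<close> in its interior. Continuity in the parameter is what identifies the limits at
  nonpositive integers.\<close>

lemma isCont_le_roy:
  assumes "n > 0" and "l > 0"
  shows "isCont (\<lambda>s. le_roy n (real l) s w) s"
proof -
  have "continuous_on {s - 1..s + 1} (\<lambda>s. le_roy n (real l) s w)"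
    by (rule uniform_limit_theorem[OF _ le_roy_uniform_limit[OF assms]])
      (auto intro!: always_eventually continuous_on_sum continuous_on_le_roy_term)
  then show ?thesis
    by (rule continuous_on_interior) simp
qed

text \<open>Writing \<open>r = k m + j\<close> with \<open>j < k\<close>, the Gamma argument moves
  by \<open>l m\<close> from its value at \<open>r = j\<close>, so each residue class is a series
  with integer step \<open>l\<close>.\<close>

lemma le_roy_multisection:
  assumes "n > 0" "l > 0" "k > 0"
  shows "le_roy n (real l / real k) \<beta> z
       = (\<Sum>j<k. z ^ j * le_roy n (real l) (\<beta> + real l / real k * real j) (z ^ k))"
proof -
  define f where "f = (\<lambda>r. z ^ r * complex_of_real (rGamma (\<beta> + real l / real k * real r)) ^ n)"
  \<comment> \<open>Padding each residue class with zeros keeps the original index \<open>r\<close>;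
    the \<open>k\<close> convergent series can then be added termwise, without
    rearrangement.\<close>
  define g where "g = (\<lambda>j r. if r mod k = j then f r else 0)"
  have "g j sums (z ^ j * le_roy n (real l) (\<beta> + real l / real k * real j) (z ^ k))" if "j < k" for j
  proof -
    have "(\<lambda>m. z ^ j * ((z ^ k) ^ m * complex_of_real (rGamma (\<beta> + real l / real k * real j + real l * real m)) ^ n))
        sums (z ^ j * le_roy n (real l) (\<beta> + real l / real k * real j) (z ^ k))"
      by (intro sums_mult sums_le_roy assms)
    also have "(\<lambda>m. z ^ j * ((z ^ k) ^ m * complex_of_real (rGamma (\<beta> + real l / real k * real j + real l * real m)) ^ n))
        = (\<lambda>m. g j (k * m + j))"
    proof
      fix m
      have "\<beta> + real l / real k * real j + real l * real m = \<beta> + real l / real k * real (k * m + j)"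
        using assms(3) by (simp add: field_simps)
      then have "f (k * m + j) = z ^ (k * m + j) *
          complex_of_real (rGamma (\<beta> + real l / real k * real j + real l * real m)) ^ n"
        by (simp only: f_def)
      then show "z ^ j * ((z ^ k) ^ m * complex_of_real (rGamma (\<beta> + real l / real k * real j + real l * real m)) ^ n)
          = g j (k * m + j)"
        using that by (simp add: g_def power_add power_mult mult_ac)
    qed
    finally show ?thesis
    proof (subst (asm) sums_mono_reindex)
      show "strict_mono (\<lambda>m. k * m + j)"
        using assms(3) by (simp add: strict_mono_def)
      show "g j r = 0" if "r \<notin> range (\<lambda>m. k * m + j)" for r
      proof (rule ccontr)
        assume "g j r \<noteq> 0"
        then have "r = k * (r div k) + j"
          by (auto simp: g_def split: if_splits)
        then show False using that by blast
      qed
    qed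
  qed
  then have "(\<lambda>r. \<Sum>j<k. g j r) sums (\<Sum>j<k. z ^ j * le_roy n (real l) (\<beta> + real l / real k * real j) (z ^ k))"
    by (intro sums_sum) auto
  moreover have "(\<Sum>j<k. g j r) = f r" for r
    using assms(3) by (simp add: g_def sum.delta)
  ultimately show ?thesis
    by (simp add: le_roy_def f_def sums_iff)
qed

text \<open>The multiplication formula collapses the \<open>n\<close> copies of the lower parameters
  to \<open>pochhammer s (l * r) ^ n\<close> up to a power of \<open>l\<close>, which the scaling of
  the argument cancels. What remains is a quotient of Gamma values.\<close>

lemma hypergeom_Delta_seq_eq_le_roy:
  fixes s :: real
  assumes "n > 0" and "l > 0" and s: "s \<notin> \<int>\<^sub>\<le>\<^sub>0"
  shows "hypergeom_pFq [1] (concat (replicate n (Delta_seq l (complex_of_real s)))) (w / of_nat l ^ (n * l))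
           / complex_of_real (Gamma s) ^ n = le_roy n (real l) s w"
proof -
  define C where "C = complex_of_real (Gamma s) ^ n"
  \<comment> \<open>\<open>Gamma\<close> takes the value 0 exactly at its poles, which
    \<open>s\<close> avoids.\<close>
  have C: "C \<noteq> 0"
    using s by (simp add: C_def Gamma_eq_zero_iff)
  have term_eq: "(w / of_nat l ^ (n * l)) ^ r / fact r *
      (prod_list (map (\<lambda>c. pochhammer c r) [1]) /
       prod_list (map (\<lambda>d. pochhammer d r) (concat (replicate n (Delta_seq l (complex_of_real s))))))
      = C * (w ^ r * complex_of_real (rGamma (s + real l * real r)) ^ n)" for r
  proof -
    define P where "P = prod_list (map (\<lambda>d. pochhammer d r) (Delta_seq l (complex_of_real s)))"
    have "of_nat l ^ (l * r) * P = complex_of_real (pochhammer s (l * r))"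
      unfolding P_def prod_list_pochhammer_Delta_seq[OF \<open>l > 0\<close>] by (simp add: pochhammer_of_real)
    also have "pochhammer s (l * r) = Gamma (s + real l * real r) / Gamma s"
      using pochhammer_Gamma[OF s, of "l * r"] by simp
    finally have "(of_nat l ^ (l * r) * P) ^ n * complex_of_real (Gamma s) ^ n
        = complex_of_real (Gamma (s + real l * real r)) ^ n"
      using s by (simp add: Gamma_eq_zero_iff flip: power_mult_distrib)
    then have "inverse (complex_of_real (Gamma (s + real l * real r)) ^ n) * C = inverse ((of_nat l ^ (l * r) * P) ^ n)"
      using C unfolding C_def by (metis inverse_mult_distrib mult.assoc mult.right_neutral right_inverse inverse_inverse_eq nonzero_imp_inverse_nonzero mult.commute)
    then have "C * complex_of_real (rGamma (s + real l * real r)) ^ n = 1 / (of_nat l ^ (n * l * r) * P ^ n)"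
      by (simp add: rGamma_inverse_Gamma power_inverse power_mult_distrib field_simps flip: power_mult)
    moreover have "(w / of_nat l ^ (n * l)) ^ r / fact r *
      (prod_list (map (\<lambda>c. pochhammer c r) [1]) /
       prod_list (map (\<lambda>d. pochhammer d r) (concat (replicate n (Delta_seq l (complex_of_real s))))))
       = w ^ r * (1 / (of_nat l ^ (n * l * r) * P ^ n))"
      \<comment> \<open>The upper parameter 1 contributes \<open>pochhammer 1 r = fact r\<close>,
        which cancels the factorial of the hypergeometric series.\<close>
      unfolding prod_list_concat_replicate P_def[symmetric]
      by (simp add: pochhammer_fact[symmetric] power_divide flip: power_mult)
    ultimately show ?thesis by (metis mult.left_commute)
  qed
  show ?thesis
    unfolding hypergeom_pFq_def term_eq le_roy_def C_def[symmetric]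
    using C sums_summable[OF sums_le_roy[OF assms(1,2), of w s]] by (simp add: suminf_mult)
qed

text \<open>At a nonpositive integer the literal term \<open>T j \<beta>\<close> divides by
  \<open>Gamma = 0\<close> and so evaluates to 0, which need not be the intended value. The second
  conjunct therefore reads such terms as limits in the parameter \<open>b\<close>.\<close>

theorem mainTheorem4:
  fixes n l k :: nat and \<beta> :: real and z :: complex
  assumes "n \<ge> 1" and "l \<ge> 1" and "k \<ge> 1" and "0 < real l / real k" and "real l / real k < 1"
  shows
    "let \<alpha> = real l / real k;
         T = (\<lambda>(j::nat) (b::real).
                z ^ j / complex_of_real (Gamma (b + \<alpha> * real j)) ^ n *
                hypergeom_pFq [1]
                  (concat (replicate n (Delta_seq l (complex_of_real (b + \<alpha> * real j)))))
                  (z ^ k / of_nat l ^ (n * l)))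
     in ((\<forall>j<k. \<beta> + \<alpha> * real j \<notin> \<int>\<^sub>\<le>\<^sub>0) \<longrightarrow> le_roy n \<alpha> \<beta> z = (\<Sum>j<k. T j \<beta>)) \<and>
        (\<exists>c :: nat \<Rightarrow> complex.
           (\<forall>j<k. if \<beta> + \<alpha> * real j \<in> \<int>\<^sub>\<le>\<^sub>0 then (T j \<longlongrightarrow> c j) (at \<beta>) else c j = T j \<beta>) \<and>
           le_roy n \<alpha> \<beta> z = (\<Sum>j<k. c j))"
proof -
  define \<alpha> where "\<alpha> = real l / real k"
  define T where "T = (\<lambda>(j::nat) (b::real).
                z ^ j / complex_of_real (Gamma (b + \<alpha> * real j)) ^ n *
                hypergeom_pFq [1]
                  (concat (replicate n (Delta_seq l (complex_of_real (b + \<alpha> * real j)))))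
                  (z ^ k / of_nat l ^ (n * l)))"
  \<comment> \<open>\<open>c j\<close> is the continuous extension of \<open>T j\<close> in
    \<open>b\<close>: it agrees with \<open>T j\<close> off the exceptional points and makes sense
    at them too.\<close>
  define c where "c = (\<lambda>j b. z ^ j * le_roy n (real l) (b + \<alpha> * real j) (z ^ k))"
  have pos: "n > 0" "l > 0" "k > 0"
    using assms by auto
  have T_eq: "T j b = c j b" if "b + \<alpha> * real j \<notin> \<int>\<^sub>\<le>\<^sub>0" for j b
    using hypergeom_Delta_seq_eq_le_roy[OF pos(1,2) that, of "z ^ k"]
    unfolding T_def c_def by (metis times_divide_eq_left times_divide_eq_right)
  have T_lim: "(T j \<longlongrightarrow> c j \<beta>) (at \<beta>)" for j
  proof (rule Lim_transform_eventually)
    have "isCont (\<lambda>b. le_roy n (real l) (b + \<alpha> * real j) (z ^ k)) \<beta>"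
      by (rule isCont_o2[OF _ isCont_le_roy[OF pos(1,2)]]) (intro continuous_intros)
    then show "(c j \<longlongrightarrow> c j \<beta>) (at \<beta>)"
      unfolding c_def isCont_def by (intro tendsto_intros)
    \<comment> \<open>The exceptional parameters form a translate of the nonpositive integers, so
      distinct ones are at least 1 apart and \<open>T j\<close> equals \<open>c j\<close> on a
      punctured neighbourhood of \<beta>.\<close>
    have "\<not> \<beta> islimpt {b. b + \<alpha> * real j \<in> \<int>\<^sub>\<le>\<^sub>0}"
    proof (rule discrete_imp_not_islimpt[of 1])
      fix x y
      assume "x \<in> {b. b + \<alpha> * real j \<in> \<int>\<^sub>\<le>\<^sub>0}" "y \<in> {b. b + \<alpha> * real j \<in> \<int>\<^sub>\<le>\<^sub>0}" "dist y x < 1"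
      then obtain p q :: int where "x + \<alpha> * real j = of_int p" "y + \<alpha> * real j = of_int q" "\<bar>y - x\<bar> < 1"
        by (auto elim!: nonpos_Ints_cases simp: dist_real_def)
      moreover from this have "\<bar>real_of_int q - real_of_int p\<bar> < 1"
        by linarith
      then have "q = p" by linarith
      ultimately show "y = x" by linarith
    qed simp
    then have "\<forall>\<^sub>F b in at \<beta>. b + \<alpha> * real j \<notin> \<int>\<^sub>\<le>\<^sub>0"
      by (simp add: islimpt_iff_eventually)
    then show "\<forall>\<^sub>F b in at \<beta>. c j b = T j b"
      by eventually_elim (simp add: T_eq)
  qed
  have sum_eq: "le_roy n \<alpha> \<beta> z = (\<Sum>j<k. c j \<beta>)"
    unfolding \<alpha>_def c_def by (rule le_roy_multisection[OF pos])
  have "le_roy n \<alpha> \<beta> z = (\<Sum>j<k. T j \<beta>)" if "\<forall>j<k. \<beta> + \<alpha> * real j \<notin> \<int>\<^sub>\<le>\<^sub>0"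
    unfolding sum_eq using that by (intro sum.cong) (auto simp: T_eq)
  moreover have "\<exists>c. (\<forall>j<k. if \<beta> + \<alpha> * real j \<in> \<int>\<^sub>\<le>\<^sub>0 then (T j \<longlongrightarrow> c j) (at \<beta>) else c j = T j \<beta>) \<and>
           le_roy n \<alpha> \<beta> z = (\<Sum>j<k. c j)"
    using T_lim T_eq sum_eq by (intro exI[of _ "\<lambda>j. c j \<beta>"]) auto
  ultimately show ?thesis
    unfolding Let_def \<alpha>_def[symmetric] T_def by blast
qed

end
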